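(* Let $A$ be a real $n\times n$ matrix and $c>0$ with $A>cI$, where $I$ is the $n\times n$ identity matrix. Then the spectral norm of $A^{-1}$ satisfies $|A^{-1}|<c^{-1}$.
   Context: For real $n\times n$ matrices (not necessarily symmetric), $A>B$ means that $A-B$ is positive definite, i.e. $x^T(A-B)x>0$ for all $x\in\mathbb{R}^n$, $x\ne0$. The spectral norm of a real matrix $M$ is $|M|=\sqrt{\rho(M^TM)}$, where $\rho$ denotes the spectral radius. *)

theory Defs
  imports "Jordan_Normal_Form.Spectral_Radius"
begin

(* Symmetry is deliberately not required. *)
definition pos_def_mat :: "real mat \<Rightarrow> bool" where
  "pos_def_mat A \<longleftrightarrow> square_mat A \<and>
     (\<forall>x \<in> carrier_vec (dim_row A). x \<noteq> 0\<^sub>v (dim_row A) \<longrightarrow> 0 < x \<bullet> (A *\<^sub>v x))"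

(* A > B; minus on matrices takes its dimensions from the second argument, so this is
   meant for A and B of equal dimensions. *)
definition mat_greater :: "real mat \<Rightarrow> real mat \<Rightarrow> bool" where
  "mat_greater A B \<longleftrightarrow> pos_def_mat (A - B)"

(* spectral_radius is defined on complex matrices, so the real matrix is embedded first
   and the radius ranges over all complex eigenvalues. It is a Max, hence meaningful
   only when M has at least one column. *)
definition spectral_norm :: "real mat \<Rightarrow> real" where
  "spectral_norm M = sqrt (spectral_radius (map_mat complex_of_real (transpose_mat M * M)))"

end

theory Submission
  imports Defs
begin

text \<open>
  The hypothesis says that the quadratic form of \<open>A\<close> exceeds \<open>c\<close> times the squared
  length. Expanding \<open>0 \<le> (A x - c x) \<bullet> (A x - c x)\<close> turns this into the expansion bound
  \<open>c\<^sup>2 (x \<bullet> x) < A x \<bullet> A x\<close> for \<open>x \<noteq> 0\<close> (lemma \<open>mat_greater_expands\<close>). So \<open>A\<close> has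
  trivial kernel, hence an inverse \<open>B\<close>, and reading the bound at \<open>x = B y\<close> shows that
  \<open>B\<close> shrinks every nonzero vector by a factor strictly below \<open>1 / c\<close>.

  It remains to pass from real vectors to the spectral radius, which ranges over complex
  eigenvalues. As \<open>B\<^sup>T B\<close> is symmetric, each such eigenvalue is real and has a real
  eigenvector \<open>x\<close> (lemma \<open>symmetric_eigenvalue_complex\<close>), so it equals the quotient of
  \<open>B x \<bullet> B x\<close> by \<open>x \<bullet> x\<close>. The spectral radius is attained at one of these finitely many
  eigenvalues, which is why the pointwise strict bound stays strict
  (lemma \<open>spectral_norm_less\<close>).
\<close>

lemma scalar_prod_self_nonneg:
  fixes x :: "real vec"
  shows "0 \<le> x \<bullet> x"
  by (auto simp: scalar_prod_def intro: sum_nonneg)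

lemma scalar_prod_self_pos:
  fixes x :: "real vec"
  assumes x: "x \<in> carrier_vec n" and "x \<noteq> 0\<^sub>v n"
  shows "0 < x \<bullet> x"
proof -
  obtain i where i: "i < n" "x $ i \<noteq> 0"
    using assms by (metis carrier_vecD eq_vecI index_zero_vec)
  have "x \<bullet> x = (\<Sum>i<n. x $ i * x $ i)"
    using x by (simp add: scalar_prod_def lessThan_atLeast0)
  moreover have "0 < (\<Sum>i<n. x $ i * x $ i)"
    using i by (intro sum_pos2[where i = i]) (auto simp: zero_less_mult_iff)
  ultimately show ?thesis by simp
qed

lemma complexified_mult_vec_Re_Im:
  fixes M :: "real mat"
  assumes M: "M \<in> carrier_mat n n" and v: "v \<in> carrier_vec n"
  shows "map_vec Re (map_mat complex_of_real M *\<^sub>v v) = M *\<^sub>v map_vec Re v"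
    and "map_vec Im (map_mat complex_of_real M *\<^sub>v v) = M *\<^sub>v map_vec Im v"
  using M v by (auto intro!: eq_vecI sum.cong simp: scalar_prod_def)

text \<open>
  Split an eigenvector into real and imaginary parts \<open>x\<close>, \<open>y\<close> and the eigenvalue into
  \<open>a + i b\<close>. Then \<open>M x = a x - b y\<close> and \<open>M y = b x + a y\<close>, and symmetry in the form
  \<open>M x \<bullet> y = x \<bullet> M y\<close> leaves \<open>b (x \<bullet> x + y \<bullet> y) = 0\<close>. So \<open>b = 0\<close>, and whichever of
  \<open>x\<close>, \<open>y\<close> is nonzero is a real eigenvector.
\<close>

lemma symmetric_eigenvalue_complex:
  fixes M :: "real mat"
  assumes M: "M \<in> carrier_mat n n" and sym: "transpose_mat M = M"
    and ev: "eigenvalue (map_mat complex_of_real M) \<mu>"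
  obtains a x where "\<mu> = complex_of_real a" "eigenvector M x a"
proof -
  let ?M = "map_mat complex_of_real M"
  obtain v where v: "v \<in> carrier_vec n" "v \<noteq> 0\<^sub>v n" "?M *\<^sub>v v = \<mu> \<cdot>\<^sub>v v"
    using ev M unfolding eigenvalue_def eigenvector_def by auto
  define x y where "x = map_vec Re v" and "y = map_vec Im v"
  define a b where "a = Re \<mu>" and "b = Im \<mu>"
  have xy: "x \<in> carrier_vec n" "y \<in> carrier_vec n"
    using v(1) by (auto simp: x_def y_def)
  have "M *\<^sub>v x = map_vec Re (\<mu> \<cdot>\<^sub>v v)" and "M *\<^sub>v y = map_vec Im (\<mu> \<cdot>\<^sub>v v)"
    using complexified_mult_vec_Re_Im[OF M v(1)] unfolding v(3) x_def y_def by simp_all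
  then have Mx: "M *\<^sub>v x = a \<cdot>\<^sub>v x - b \<cdot>\<^sub>v y" and My: "M *\<^sub>v y = b \<cdot>\<^sub>v x + a \<cdot>\<^sub>v y"
    using v(1) by (auto intro!: eq_vecI simp: x_def y_def a_def b_def)
  have nz: "x \<noteq> 0\<^sub>v n \<or> y \<noteq> 0\<^sub>v n"
  proof (rule ccontr)
    assume "\<not> ?thesis"
    then have xy0: "x = 0\<^sub>v n" "y = 0\<^sub>v n" by auto
    have "v $ i = 0" if "i < n" for i
    proof -
      have "Re (v $ i) = x $ i" "Im (v $ i) = y $ i"
        using that v(1) by (simp_all add: x_def y_def)
      then show ?thesis using that by (simp add: xy0 complex_eq_iff)
    qed
    then show False using v(1,2) by (auto intro!: eq_vecI)
  qed
  have "(M *\<^sub>v x) \<bullet> y = x \<bullet> (M *\<^sub>v y)"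
    using transpose_vec_mult_scalar[OF M xy(2) xy(1)] sym by simp
  then have "b * (x \<bullet> x + y \<bullet> y) = 0"
    unfolding Mx My using xy
    by (simp add: minus_scalar_prod_distrib[of _ n] scalar_prod_add_distrib[of _ n] algebra_simps)
  moreover have "0 < x \<bullet> x + y \<bullet> y"
    using nz scalar_prod_self_pos[OF xy(1)] scalar_prod_self_pos[OF xy(2)]
      scalar_prod_self_nonneg[of x] scalar_prod_self_nonneg[of y] by linarith
  ultimately have b: "b = 0" by simp
  have "M *\<^sub>v x = a \<cdot>\<^sub>v x" "M *\<^sub>v y = a \<cdot>\<^sub>v y"
    using Mx My xy unfolding b by auto
  then have "eigenvector M x a \<or> eigenvector M y a"
    using nz xy M unfolding eigenvector_def by auto
  moreover have "\<mu> = complex_of_real a"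
    using b by (simp add: a_def b_def complex_eq_iff)
  ultimately show ?thesis using that by blast
qed

text \<open>
  For an eigenvector \<open>x\<close> of \<open>B\<^sup>T B\<close> with real eigenvalue \<open>a\<close>, moving \<open>B\<^sup>T\<close> across the
  product gives \<open>B x \<bullet> B x = B\<^sup>T B x \<bullet> x = a (x \<bullet> x)\<close>. Hence \<open>0 \<le> a < r\<^sup>2\<close>; applied to an
  eigenvalue of largest modulus this bounds the spectral radius.
\<close>

lemma spectral_norm_less:
  fixes B :: "real mat"
  assumes n: "0 < n" and B: "B \<in> carrier_mat n n" and r: "0 \<le> r"
    and shrink: "\<And>x. x \<in> carrier_vec n \<Longrightarrow> x \<noteq> 0\<^sub>v n \<Longrightarrow>
      (B *\<^sub>v x) \<bullet> (B *\<^sub>v x) < r\<^sup>2 * (x \<bullet> x)"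
  shows "spectral_norm B < r"
proof -
  define M where "M = transpose_mat B * B"
  let ?M = "map_mat complex_of_real M"
  have M: "M \<in> carrier_mat n n" using B by (simp add: M_def)
  have sym: "transpose_mat M = M"
    using B by (simp add: M_def transpose_mult[of _ n n _ n])
  obtain \<mu> where ev: "eigenvalue ?M \<mu>" and rad: "spectral_radius ?M = cmod \<mu>"
    using spectral_radius_mem_max(1)[of ?M n] M n unfolding spectrum_def by auto
  obtain a x where \<mu>: "\<mu> = complex_of_real a" and evx: "eigenvector M x a"
    using symmetric_eigenvalue_complex[OF M sym ev] .
  have x: "x \<in> carrier_vec n" "x \<noteq> 0\<^sub>v n" "M *\<^sub>v x = a \<cdot>\<^sub>v x"
    using evx M unfolding eigenvector_def by auto
  have "(B *\<^sub>v x) \<bullet> (B *\<^sub>v x) = (M *\<^sub>v x) \<bullet> x"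
    using transpose_vec_mult_scalar[OF B x(1), of "B *\<^sub>v x"] B x(1)
    by (simp add: M_def assoc_mult_mat_vec[of _ n n _ n])
  also have "\<dots> = a * (x \<bullet> x)"
    using x by simp
  finally have Bx: "(B *\<^sub>v x) \<bullet> (B *\<^sub>v x) = a * (x \<bullet> x)" .
  have pos: "0 < x \<bullet> x" using scalar_prod_self_pos x by blast
  have "a < r\<^sup>2" using shrink[OF x(1,2)] pos unfolding Bx by simp
  moreover have "0 \<le> a"
    using scalar_prod_self_nonneg[of "B *\<^sub>v x"] pos unfolding Bx by (simp add: zero_le_mult_iff)
  ultimately have "sqrt (spectral_radius ?M) < r"
    using r unfolding rad \<mu> by (simp add: real_less_lsqrt)
  then show ?thesis by (simp add: spectral_norm_def M_def)
qed

text \<open>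
  Positivity bounds the form from below: \<open>c (x \<bullet> x) < x \<bullet> A x\<close>. In
  \<open>0 \<le> (A x - c x) \<bullet> (A x - c x) = A x \<bullet> A x - 2 c (x \<bullet> A x) + c\<^sup>2 (x \<bullet> x)\<close> this makes the
  middle term smaller than \<open>- 2 c\<^sup>2 (x \<bullet> x)\<close>, which leaves the claim.
\<close>

lemma mat_greater_expands:
  fixes A :: "real mat"
  assumes A: "A \<in> carrier_mat n n" and c: "0 < c"
    and gr: "mat_greater A (c \<cdot>\<^sub>m 1\<^sub>m n)"
    and x: "x \<in> carrier_vec n" "x \<noteq> 0\<^sub>v n"
  shows "c\<^sup>2 * (x \<bullet> x) < (A *\<^sub>v x) \<bullet> (A *\<^sub>v x)"
proof -
  have Ax: "A *\<^sub>v x \<in> carrier_vec n" using A x(1) by simp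
  have I: "(c \<cdot>\<^sub>m 1\<^sub>m n) *\<^sub>v x = c \<cdot>\<^sub>v x"
    using x(1) by (auto intro!: eq_vecI)
  have "0 < x \<bullet> ((A - c \<cdot>\<^sub>m 1\<^sub>m n) *\<^sub>v x)"
    using gr A x unfolding mat_greater_def pos_def_mat_def by auto
  also have "(A - c \<cdot>\<^sub>m 1\<^sub>m n) *\<^sub>v x = A *\<^sub>v x - c \<cdot>\<^sub>v x"
    using minus_mult_distrib_mat_vec[OF A _ x(1), of "c \<cdot>\<^sub>m 1\<^sub>m n"] I by simp
  finally have form: "c * (x \<bullet> x) < x \<bullet> (A *\<^sub>v x)"
    using x(1) Ax by (simp add: scalar_prod_minus_distrib[of _ n])
  have "0 \<le> (A *\<^sub>v x - c \<cdot>\<^sub>v x) \<bullet> (A *\<^sub>v x - c \<cdot>\<^sub>v x)"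
    by (rule scalar_prod_self_nonneg)
  also have "\<dots> = (A *\<^sub>v x) \<bullet> (A *\<^sub>v x) - 2 * c * (x \<bullet> (A *\<^sub>v x)) + c\<^sup>2 * (x \<bullet> x)"
    using x(1) Ax
    by (simp add: minus_scalar_prod_distrib[of _ n] scalar_prod_minus_distrib[of _ n]
        comm_scalar_prod[of "A *\<^sub>v x" n x] power2_eq_square algebra_simps)
  finally have "0 \<le> (A *\<^sub>v x) \<bullet> (A *\<^sub>v x) - 2 * (c * (x \<bullet> (A *\<^sub>v x))) + c\<^sup>2 * (x \<bullet> x)"
    by (simp add: mult.assoc)
  moreover have "c\<^sup>2 * (x \<bullet> x) < c * (x \<bullet> (A *\<^sub>v x))"
    using mult_strict_left_mono[OF form c] by (simp add: power2_eq_square mult.assoc)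
  ultimately show ?thesis by linarith
qed

lemma trivial_kernel_imp_inverse:
  fixes A :: "'a :: field mat"
  assumes A: "A \<in> carrier_mat n n"
    and ker: "\<And>x. x \<in> carrier_vec n \<Longrightarrow> A *\<^sub>v x = 0\<^sub>v n \<Longrightarrow> x = 0\<^sub>v n"
  obtains B where "B \<in> carrier_mat n n" "A * B = 1\<^sub>m n" "B * A = 1\<^sub>m n"
proof -
  have "det A \<noteq> 0"
    using ker det_0_iff_vec_prod_zero_field[OF A] by blast
  then have "A \<in> Units (ring_mat TYPE('a) n ())"
    by (rule det_non_zero_imp_unit[OF A])
  then show ?thesis
    using that by (auto simp: Units_def ring_mat_def)
qed

theorem lemma5p2:
  fixes A :: "real mat" and n :: nat and c :: real
  assumes "0 < n"
    and "A \<in> carrier_mat n n"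
    and "0 < c"
    and "mat_greater A (c \<cdot>\<^sub>m 1\<^sub>m n)"
  shows "\<exists>B \<in> carrier_mat n n. inverts_mat A B \<and> inverts_mat B A \<and> spectral_norm B < inverse c"
proof -
  note A = assms(2) and c = assms(3)
  note expands = mat_greater_expands[OF A c assms(4)]
  have "x = 0\<^sub>v n" if x: "x \<in> carrier_vec n" and Ax: "A *\<^sub>v x = 0\<^sub>v n" for x
  proof (rule ccontr)
    assume "x \<noteq> 0\<^sub>v n"
    from expands[OF x this] have "c\<^sup>2 * (x \<bullet> x) < 0" unfolding Ax by simp
    then show False using scalar_prod_self_nonneg[of x] by (simp add: mult_less_0_iff)
  qed
  then obtain B where B: "B \<in> carrier_mat n n" and AB: "A * B = 1\<^sub>m n" and BA: "B * A = 1\<^sub>m n"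
    using trivial_kernel_imp_inverse[OF A] by blast
  have "(B *\<^sub>v y) \<bullet> (B *\<^sub>v y) < (inverse c)\<^sup>2 * (y \<bullet> y)"
    if y: "y \<in> carrier_vec n" "y \<noteq> 0\<^sub>v n" for y
  proof -
    have ABy: "A *\<^sub>v (B *\<^sub>v y) = y"
      using A B y(1) AB by (metis assoc_mult_mat_vec one_mult_mat_vec)
    have "A *\<^sub>v 0\<^sub>v n = 0\<^sub>v n" using A by (auto intro!: eq_vecI)
    with ABy y(2) have "B *\<^sub>v y \<noteq> 0\<^sub>v n" by metis
    then have "c\<^sup>2 * ((B *\<^sub>v y) \<bullet> (B *\<^sub>v y)) < y \<bullet> y"
      using expands[of "B *\<^sub>v y"] B y(1) unfolding ABy by simp
    then show ?thesis using c by (simp add: field_simps)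
  qed
  then have "spectral_norm B < inverse c"
    using spectral_norm_less[OF assms(1) B] c by simp
  moreover have "inverts_mat A B" "inverts_mat B A"
    using A B AB BA by (auto simp: inverts_mat_def)
  ultimately show ?thesis using B by blast
qed

end
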